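(* Let $\mathcal{H}$ be a separable right quaternionic Hilbert space with a fixed orthonormal basis $\{e_n:n\in\mathbb{N}\}$, let $q\in\mathbb{H}$, let $L_q$ be the left multiplication operator $L_q(x)=\sum_{n\in\mathbb{N}}e_n\, q\,\langle e_n,x\rangle$ on $\mathcal{H}$, and let $\varepsilon>0$. If $\varepsilon<|\mathrm{Im}(q)|^2$, then $\Lambda_\varepsilon^S(L_q)\cap\mathbb{R}$ is empty. Otherwise (i.e. if $\varepsilon\ge|\mathrm{Im}(q)|^2$), $\Lambda_\varepsilon^S(L_q)\cap\mathbb{R}$ is a non-empty connected set.
   Context: $\mathbb{H}$ is the division ring of real quaternions; $\mathrm{Re}(q)$, $\mathrm{Im}(q)=q-\mathrm{Re}(q)$ and $|q|$ denote the real part, imaginary part and modulus of $q\in\mathbb{H}$. A right quaternionic Hilbert space is a right $\mathbb{H}$-module with an $\mathbb{H}$-valued inner product (positive definite, right $\mathbb{H}$-linear in the second variable, $\langle x,y\rangle=\overline{\langle y,x\rangle}$), complete in the induced norm. $\mathcal{B}(\mathcal{H})$ is the real Banach algebra of bounded right $\mathbb{H}$-linear operators on $\mathcal{H}$ with the operator norm. For $T\in\mathcal{B}(\mathcal{H})$ and $p\in\mathbb{H}$ put $Q_p(T)=T^2-2\,\mathrm{Re}(p)T+|p|^2I$. The $S$-spectrum is $\sigma_S(T)=\{p\in\mathbb{H}: Q_p(T)\text{ is not invertible in }\mathcal{B}(\mathcal{H})\}$. For $\varepsilon>0$ the pseudo $S$-spectrum is $\Lambda_\varepsilon^S(T)=\sigma_S(T)\cup\{p\in\mathbb{H}\setminus\sigma_S(T):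 \|Q_p(T)^{-1}\|\ge 1/\varepsilon\}$. *)

theory Defs
  imports "HOL-Analysis.Analysis"
begin

datatype quat = Quat (qRe: real) (qI: real) (qJ: real) (qK: real)

lemma quat_eq_iff: "x = y \<longleftrightarrow> qRe x = qRe y \<and> qI x = qI y \<and> qJ x = qJ y \<and> qK x = qK y"
  by (cases x; cases y) simp

instantiation quat :: ring_1
begin

definition "0 = Quat 0 0 0 0"
definition "1 = Quat 1 0 0 0"
definition "x + y = Quat (qRe x + qRe y) (qI x + qI y) (qJ x + qJ y) (qK x + qK y)"
definition "x - y = Quat (qRe x - qRe y) (qI x - qI y) (qJ x - qJ y) (qK x - qK y)"
definition "- x = Quat (- qRe x) (- qI x) (- qJ x) (- qK x)"
definition "x * y = Quat
  (qRe x * qRe y - qI x * qI y - qJ x * qJ y - qK x * qK y)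
  (qRe x * qI y + qI x * qRe y + qJ x * qK y - qK x * qJ y)
  (qRe x * qJ y - qI x * qK y + qJ x * qRe y + qK x * qI y)
  (qRe x * qK y + qI x * qJ y - qJ x * qI y + qK x * qRe y)"

instance
  by standard
    (simp_all add: zero_quat_def one_quat_def plus_quat_def minus_quat_def uminus_quat_def
      times_quat_def algebra_simps)

end

instantiation quat :: real_algebra_1
begin

definition "scaleR r x = Quat (r * qRe x) (r * qI x) (r * qJ x) (r * qK x)"

instance
  by standard
    (simp_all add: scaleR_quat_def plus_quat_def times_quat_def quat_eq_iff algebra_simps)

end

lemma quat_sel_simps [simp]:
  "qRe 0 = 0" "qI 0 = 0" "qJ 0 = 0" "qK 0 = 0"
  "qRe 1 = 1" "qI 1 = 0" "qJ 1 = 0" "qK 1 = 0"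
  "qRe (x + y) = qRe x + qRe y" "qI (x + y) = qI x + qI y"
  "qJ (x + y) = qJ x + qJ y" "qK (x + y) = qK x + qK y"
  "qRe (x - y) = qRe x - qRe y" "qI (x - y) = qI x - qI y"
  "qJ (x - y) = qJ x - qJ y" "qK (x - y) = qK x - qK y"
  "qRe (- x) = - qRe x" "qI (- x) = - qI x" "qJ (- x) = - qJ x" "qK (- x) = - qK x"
  "qRe (r *\<^sub>R x) = r * qRe x" "qI (r *\<^sub>R x) = r * qI x"
  "qJ (r *\<^sub>R x) = r * qJ x" "qK (r *\<^sub>R x) = r * qK x"
  by (simp_all add: zero_quat_def one_quat_def plus_quat_def minus_quat_def uminus_quat_def
      scaleR_quat_def)

lemma quat_sel_mult:
  "qRe (x * y) = qRe x * qRe y - qI x * qI y - qJ x * qJ y - qK x * qK y"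
  "qI (x * y) = qRe x * qI y + qI x * qRe y + qJ x * qK y - qK x * qJ y"
  "qJ (x * y) = qRe x * qJ y - qI x * qK y + qJ x * qRe y + qK x * qI y"
  "qK (x * y) = qRe x * qK y + qI x * qJ y - qJ x * qI y + qK x * qRe y"
  by (simp_all add: times_quat_def)

lemma quat_sel_of_real [simp]:
  "qRe (of_real r) = r" "qI (of_real r) = 0" "qJ (of_real r) = 0" "qK (of_real r) = 0"
  by (simp_all add: of_real_def)

definition qcnj :: "quat \<Rightarrow> quat" where
  "qcnj x = Quat (qRe x) (- qI x) (- qJ x) (- qK x)"

definition qIm :: "quat \<Rightarrow> quat" where
  "qIm x = x - of_real (qRe x)"

instantiation quat :: real_inner
begin

definition inner_quat :: "quat \<Rightarrow> quat \<Rightarrow> real" where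
  "inner_quat x y = qRe x * qRe y + qI x * qI y + qJ x * qJ y + qK x * qK y"

definition norm_quat :: "quat \<Rightarrow> real" where
  "norm_quat x = sqrt ((qRe x)\<^sup>2 + (qI x)\<^sup>2 + (qJ x)\<^sup>2 + (qK x)\<^sup>2)"

definition sgn_quat :: "quat \<Rightarrow> quat" where
  "sgn_quat x = x /\<^sub>R norm x"

definition dist_quat :: "quat \<Rightarrow> quat \<Rightarrow> real" where
  "dist_quat x y = norm (x - y)"

definition uniformity_quat :: "(quat \<times> quat) filter" where
  "uniformity_quat = (INF e\<in>{0 <..}. principal {(x, y). dist x y < e})"

definition open_quat :: "quat set \<Rightarrow> bool" where
  "open_quat U \<longleftrightarrow> (\<forall>x\<in>U. eventually (\<lambda>(x', y). x' = x \<longrightarrow> y \<in> U) uniformity)"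

instance
proof
  fix x :: quat
  have "qRe x * qRe x + qI x * qI x + qJ x * qJ x + qK x * qK x = 0 \<Longrightarrow> x = 0"
    unfolding quat_eq_iff
    by (metis add_nonneg_eq_0_iff add_nonneg_nonneg mult_eq_0_iff quat_sel_simps(1-4)
        zero_le_square)
  then show "inner x x = 0 \<longleftrightarrow> x = 0"
    by (auto simp: inner_quat_def)
qed (auto simp: inner_quat_def norm_quat_def sgn_quat_def dist_quat_def uniformity_quat_def
      open_quat_def algebra_simps power2_eq_square)

end

instantiation quat :: real_normed_div_algebra
begin

definition inverse_quat :: "quat \<Rightarrow> quat" where
  "inverse_quat x = qcnj x /\<^sub>R (norm x)\<^sup>2"

definition divide_quat :: "quat \<Rightarrow> quat \<Rightarrow> quat" where
  "divide_quat x y = x * inverse y"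

instance
proof
  fix x y :: quat
  have cnj: "qcnj x * x = of_real ((norm x)\<^sup>2)" "x * qcnj x = of_real ((norm x)\<^sup>2)"
    by (simp_all add: quat_eq_iff quat_sel_mult qcnj_def norm_quat_def power2_eq_square
        algebra_simps)
  show "x \<noteq> 0 \<Longrightarrow> inverse x * x = 1" and "x \<noteq> 0 \<Longrightarrow> x * inverse x = 1"
    by (simp_all add: inverse_quat_def cnj of_real_def)
  show "x div y = x * inverse y"
    by (rule divide_quat_def)
  show "inverse (0::quat) = 0"
    by (simp add: inverse_quat_def qcnj_def quat_eq_iff)
  show "norm (x * y) = norm x * norm y"
    unfolding norm_quat_def real_sqrt_mult [symmetric] quat_sel_mult
    by (rule arg_cong [where f = sqrt]) algebra
qed

end

text \<open>
  The structure of a real Banach space is the one induced by the quaternionic structure: real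
  scalars act as real quaternions, and the norm is the one induced by the inner product.
\<close>

class quat_hilbert = banach +
  fixes rscale :: "'a \<Rightarrow> quat \<Rightarrow> 'a" (infixl "*\<^sub>H" 75)
    and qinner :: "'a \<Rightarrow> 'a \<Rightarrow> quat"
  assumes rscale_add_left: "(x + y) *\<^sub>H p = x *\<^sub>H p + y *\<^sub>H p"
    and rscale_add_right: "x *\<^sub>H (p + r) = x *\<^sub>H p + x *\<^sub>H r"
    and rscale_mult: "x *\<^sub>H (p * r) = x *\<^sub>H p *\<^sub>H r"
    and rscale_one: "x *\<^sub>H 1 = x"
    and scaleR_conv_rscale: "a *\<^sub>R x = x *\<^sub>H of_real a"
    and qinner_add_right: "qinner x (y + z) = qinner x y + qinner x z"
    and qinner_rscale_right: "qinner x (y *\<^sub>H p) = qinner x y * p"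
    and qinner_commute: "qinner x y = qcnj (qinner y x)"
    and qinner_pos: "x \<noteq> 0 \<Longrightarrow> qRe (qinner x x) > 0"
    and norm_eq_sqrt_qinner: "norm x = sqrt (qRe (qinner x x))"

definition orthonormal_basis :: "(nat \<Rightarrow> 'h::quat_hilbert) \<Rightarrow> bool" where
  "orthonormal_basis e \<longleftrightarrow>
     (\<forall>m n. qinner (e m) (e n) = (if m = n then 1 else 0)) \<and>
     closure {(\<Sum>n<N. e n *\<^sub>H c n) | N c. True} = UNIV"

definition bounded_ops :: "('h::quat_hilbert \<Rightarrow> 'h) set" where
  "bounded_ops = {T. bounded_linear T \<and> (\<forall>x p. T (x *\<^sub>H p) = T x *\<^sub>H p)}"

definition invertible_op :: "('h::quat_hilbert \<Rightarrow> 'h) \<Rightarrow> bool" where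
  "invertible_op A \<longleftrightarrow> (\<exists>B\<in>bounded_ops. A \<circ> B = id \<and> B \<circ> A = id)"

definition Q_op :: "quat \<Rightarrow> ('h::quat_hilbert \<Rightarrow> 'h) \<Rightarrow> 'h \<Rightarrow> 'h" where
  "Q_op p T = (\<lambda>x. T (T x) - (2 * qRe p) *\<^sub>R T x + (norm p)\<^sup>2 *\<^sub>R x)"

definition S_spectrum :: "('h::quat_hilbert \<Rightarrow> 'h) \<Rightarrow> quat set" where
  "S_spectrum T = {p. \<not> invertible_op (Q_op p T)}"

text \<open>
  Outside the S-spectrum, the inverse function \<open>inv (Q_op p T)\<close> is the inverse of \<open>Q_op p T\<close> in
  the algebra of bounded operators, and \<open>onorm\<close> is its operator norm.
\<close>

definition pseudo_S_spectrum :: "real \<Rightarrow> ('h::quat_hilbert \<Rightarrow> 'h) \<Rightarrow> quat set" where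
  "pseudo_S_spectrum \<epsilon> T =
     S_spectrum T \<union> {p. p \<notin> S_spectrum T \<and> onorm (inv (Q_op p T)) \<ge> 1 / \<epsilon>}"

definition left_mult_op :: "(nat \<Rightarrow> 'h::quat_hilbert) \<Rightarrow> quat \<Rightarrow> 'h \<Rightarrow> 'h" where
  "left_mult_op e q x = (\<Sum>n. e n *\<^sub>H q *\<^sub>H qinner (e n) x)"

end

theory Submission
  imports Defs
begin

text \<open>
  The map \<open>q \<mapsto> L\<^sub>q\<close> is multiplicative and real-linear, and \<open>\<parallel>L\<^sub>q x\<parallel> = \<bar>q\<bar> \<parallel>x\<parallel>\<close> by Parseval. For real
  \<open>t\<close> the operator \<open>Q\<^sub>t(L\<^sub>q)\<close> is therefore \<open>L\<^sub>r\<close> with \<open>r = (q - t)\<^sup>2\<close>: it vanishes if \<open>q = t\<close>, and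
  otherwise its inverse has norm \<open>\<bar>q - t\<bar>\<close> to the power \<open>-2\<close>. So \<open>t\<close> lies in the pseudo S-spectrum
  iff \<open>(t - Re q)\<^sup>2 + \<bar>Im q\<bar>\<^sup>2 \<le> \<epsilon>\<close>, which describes a closed interval around \<open>Re q\<close>.
\<close>

section \<open>Algebra of the quaternionic inner product and its norm\<close>

lemma qcnj_simps [simp]:
  "qcnj 0 = 0" "qcnj (x + y) = qcnj x + qcnj y" "qcnj (x * y) = qcnj y * qcnj x"
  by (simp_all add: qcnj_def quat_eq_iff quat_sel_mult algebra_simps)

lemma qcnj_mult_self: "qcnj x * x = of_real ((norm x)\<^sup>2)"
  by (simp add: quat_eq_iff quat_sel_mult qcnj_def norm_quat_def power2_eq_square algebra_simps)

lemma qinner_rscale_left: "qinner (x *\<^sub>H p) y = qcnj p * qinner x y"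
  by (metis qcnj_simps(3) qinner_commute qinner_rscale_right)

lemma qinner_add_left: "qinner (x + y) z = qinner x z + qinner y z"
  by (metis qcnj_simps(2) qinner_commute qinner_add_right)

lemma qinner_zero_right [simp]: "qinner x 0 = 0"
  using qinner_add_right[of x 0 0] by simp

lemma qinner_zero_left [simp]: "qinner 0 x = 0"
  using qinner_add_left[of 0 0 x] by simp

lemma qinner_diff_right: "qinner x (y - z) = qinner x y - qinner x z"
  using qinner_add_right[of x "y - z" z] by (simp add: algebra_simps)

lemma qinner_sum_right: "qinner x (\<Sum>i\<in>A. f i) = (\<Sum>i\<in>A. qinner x (f i))"
  by (induction A rule: infinite_finite_induct) (simp_all add: qinner_add_right)

lemma qinner_sum_left: "qinner (\<Sum>i\<in>A. f i) x = (\<Sum>i\<in>A. qinner (f i) x)"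
  by (induction A rule: infinite_finite_induct) (simp_all add: qinner_add_left)

lemma qinner_scaleR_right: "qinner x (a *\<^sub>R y) = a *\<^sub>R qinner x y"
  by (simp add: scaleR_conv_rscale qinner_rscale_right quat_eq_iff quat_sel_mult)

lemma qinner_self_Re: "qRe (qinner x x) = (norm x)\<^sup>2"
proof -
  have "qRe (qinner x x) \<ge> 0"
    using qinner_pos[of x] by (cases "x = 0") auto
  then show ?thesis
    by (simp add: norm_eq_sqrt_qinner)
qed

text \<open>Hermitian symmetry makes each imaginary component of \<open>qinner x x\<close> equal to
  its own negative.\<close>

lemma qinner_self: "qinner x x = of_real ((norm x)\<^sup>2)"
proof -
  have "qI (qinner x x) = - qI (qinner x x)" "qJ (qinner x x) = - qJ (qinner x x)"
    "qK (qinner x x) = - qK (qinner x x)"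
    by (subst (1) qinner_commute, simp add: qcnj_def)+
  then show ?thesis
    by (simp add: quat_eq_iff qinner_self_Re del: of_real_power)
qed

lemma norm_rscale: "norm (x *\<^sub>H p) = norm x * norm p"
proof -
  have "of_real ((norm (x *\<^sub>H p))\<^sup>2) = qcnj p * of_real ((norm x)\<^sup>2) * p"
    by (simp only: qinner_self[symmetric] qinner_rscale_left qinner_rscale_right mult.assoc)
  \<comment> \<open>Real quaternions are central, so the squared norm moves out from between
    \<open>qcnj p\<close> and \<open>p\<close>.\<close>
  also have "\<dots> = of_real ((norm x)\<^sup>2) * (qcnj p * p)"
    by (simp add: of_real_def)
  also have "\<dots> = of_real ((norm x * norm p)\<^sup>2)"
    by (simp add: qcnj_mult_self power_mult_distrib)
  finally have "(norm (x *\<^sub>H p))\<^sup>2 = (norm x * norm p)\<^sup>2"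
    by (simp only: of_real_eq_iff)
  then show ?thesis
    by (simp add: power2_eq_iff_nonneg)
qed

lemma pythagoras:
  assumes "qinner x y = 0"
  shows "(norm (x + y))\<^sup>2 = (norm x)\<^sup>2 + (norm y)\<^sup>2"
proof -
  have "qinner y x = 0"
    using assms qinner_commute[of y x] by simp
  then show ?thesis
    using assms by (simp add: qinner_self_Re[symmetric] qinner_add_left qinner_add_right)
qed

lemma rscale_scaleR_left: "(a *\<^sub>R x) *\<^sub>H p = a *\<^sub>R (x *\<^sub>H p)"
  by (simp add: scaleR_conv_rscale rscale_mult[symmetric] of_real_def)

lemma bounded_linear_rscale_left: "bounded_linear (\<lambda>x. x *\<^sub>H p)"
  by (rule bounded_linear_intro[of _ "norm p"])
    (simp_all add: rscale_add_left rscale_scaleR_left norm_rscale)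

lemma rscale_zero_right [simp]: "x *\<^sub>H 0 = 0"
  using rscale_add_right[of x 0 0] by simp

lemma rscale_diff_right: "x *\<^sub>H (p - q) = x *\<^sub>H p - x *\<^sub>H q"
  using rscale_add_right[of x "p - q" q] by (simp add: algebra_simps)

lemma rscale_scaleR_right: "x *\<^sub>H (a *\<^sub>R p) = a *\<^sub>R (x *\<^sub>H p)"
proof -
  have "a *\<^sub>R p = p * of_real a"
    by (simp add: of_real_def)
  then show ?thesis
    by (simp add: scaleR_conv_rscale rscale_mult)
qed

section \<open>Orthonormal expansions and convergence of the series for
  \<open>left_mult_op\<close>\<close>

context
  fixes e :: "nat \<Rightarrow> 'h::quat_hilbert"
  assumes onb: "orthonormal_basis e"
begin

lemma qinner_basis: "qinner (e m) (e n) = (if m = n then 1 else 0)"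
  using onb by (simp add: orthonormal_basis_def)

lemma norm_basis [simp]: "norm (e n) = 1"
  by (simp add: norm_eq_sqrt_qinner qinner_basis)

lemma qinner_basis_sum:
  assumes "finite A"
  shows "qinner (e m) (\<Sum>n\<in>A. e n *\<^sub>H c n) = (if m \<in> A then c m else 0)"
  using assms by (simp add: qinner_sum_right qinner_rscale_right qinner_basis if_distrib[of "\<lambda>z. z * _"]
      cong: if_cong)

lemma norm_sum_basis:
  assumes "finite A"
  shows "(norm (\<Sum>n\<in>A. e n *\<^sub>H c n))\<^sup>2 = (\<Sum>n\<in>A. (norm (c n))\<^sup>2)"
  using assms
proof induction
  case (insert m A)
  have "qinner (e m *\<^sub>H c m) (\<Sum>n\<in>A. e n *\<^sub>H c n) = 0"
    using insert by (simp add: qinner_rscale_left qinner_basis_sum)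
  from pythagoras[OF this] show ?case
    using insert by (simp add: norm_rscale)
qed simp

text \<open>The coefficients \<open>q * c n\<close> have modulus \<open>norm q * norm (c n)\<close>,
  so Pythagoras pulls out the factor. Arbitrary finite index sets cover both partial sums and Cauchy
  blocks.\<close>

lemma norm_sum_basis_mult:
  assumes "finite A"
  shows "norm (\<Sum>n\<in>A. e n *\<^sub>H q *\<^sub>H c n) = norm q * norm (\<Sum>n\<in>A. e n *\<^sub>H c n)"
proof -
  have "(norm (\<Sum>n\<in>A. e n *\<^sub>H q *\<^sub>H c n))\<^sup>2 = (norm q * norm (\<Sum>n\<in>A. e n *\<^sub>H c n))\<^sup>2"
    using assms
    by (simp add: rscale_mult[symmetric] norm_sum_basis norm_mult power_mult_distrib sum_distrib_left)
  then show ?thesis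
    by (simp add: power2_eq_iff_nonneg)
qed

text \<open>Bessel's inequality: the partial expansion is an orthogonal projection of
  \<open>x\<close>, so Pythagoras applies to it and the remainder.\<close>

lemma norm_partial_expansion_le: "norm (\<Sum>n<N. e n *\<^sub>H qinner (e n) x) \<le> norm x"
proof -
  define y where "y = (\<Sum>n<N. e n *\<^sub>H qinner (e n) x)"
  have "qinner (e n) (x - y) = 0" if "n < N" for n
    using that by (simp add: y_def qinner_diff_right qinner_basis_sum)
  then have "qinner y (x - y) = 0"
    \<comment> \<open>Only the first \<open>y\<close> is unfolded, so that the orthogonality of each
      \<open>e n\<close> to \<open>x - y\<close> still applies.\<close>
    by (subst (1) y_def) (simp add: qinner_sum_left qinner_rscale_left)
  from pythagoras[OF this] have "(norm y)\<^sup>2 \<le> (norm x)\<^sup>2"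
    by simp
  then show ?thesis
    unfolding y_def by (rule power2_le_imp_le) simp
qed

text \<open>Finite combinations of the basis are dense and are fixed by all late partial expansions;
  since these expansions are contractions, the approximation passes to \<open>x\<close>.\<close>

lemma basis_expansion: "(\<lambda>n. e n *\<^sub>H qinner (e n) x) sums x"
  unfolding sums_def
proof (rule LIMSEQ_I)
  fix r :: real
  assume "r > 0"
  define P where "P N x = (\<Sum>n<N. e n *\<^sub>H qinner (e n) x)" for N x
  have "x \<in> closure {(\<Sum>n<N. e n *\<^sub>H c n) | N c. True}"
    using onb by (simp add: orthonormal_basis_def)
  \<comment> \<open>The distance to \<open>y\<close> enters twice in the final estimate, hence
    \<open>r / 2\<close>.\<close>
  then have "\<exists>y\<in>{(\<Sum>n<N. e n *\<^sub>H c n) | N c. True}. dist y x < r / 2"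
    using half_gt_zero[OF \<open>r > 0\<close>] unfolding closure_approachable by blast
  then obtain M c where y: "dist (\<Sum>n<M. e n *\<^sub>H c n) x < r / 2"
    by auto
  define y where "y = (\<Sum>n<M. e n *\<^sub>H c n)"
  have "norm (P N x - x) < r" if "N \<ge> M" for N
  proof -
    \<comment> \<open>The coefficients of \<open>y\<close> vanish from index \<open>M\<close> on, so
      \<open>P N\<close> reproduces \<open>y\<close> once \<open>N\<close> is at least
      \<open>M\<close>.\<close>
    have "P N y = (\<Sum>n<N. if n \<in> {..<M} then e n *\<^sub>H c n else 0)"
      unfolding P_def y_def by (rule sum.cong) (auto simp: qinner_basis_sum)
    also have "\<dots> = y"
      using that by (subst sum.inter_restrict[symmetric]) (auto simp: y_def intro!: sum.cong)
    finally have "P N y = y" .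
    have "P N (x - y) = P N x - P N y"
      unfolding P_def sum_subtractf[symmetric]
      by (simp only: qinner_diff_right rscale_diff_right)
    then have "P N x - x = P N (x - y) - (x - y)"
      using \<open>P N y = y\<close> by simp
    also have "norm \<dots> \<le> norm (P N (x - y)) + norm (x - y)"
      by (rule norm_triangle_ineq4)
    also have "\<dots> \<le> norm (x - y) + norm (x - y)"
      unfolding P_def by (rule add_right_mono[OF norm_partial_expansion_le])
    also have "\<dots> < r"
      using y by (simp add: y_def dist_norm norm_minus_commute)
    finally show ?thesis .
  qed
  then show "\<exists>M. \<forall>N\<ge>M. norm ((\<Sum>n<N. e n *\<^sub>H qinner (e n) x) - x) < r"
    unfolding P_def by blast
qed

text \<open>A single squared coefficient is one summand of the squared norm of a partial expansion.
  The resulting continuity later allows \<open>qinner (e n)\<close> to be applied to series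
  termwise.\<close>

lemma norm_qinner_basis_le: "norm (qinner (e n) x) \<le> norm x"
proof -
  have "(norm (qinner (e n) x))\<^sup>2 \<le> (\<Sum>k<Suc n. (norm (qinner (e k) x))\<^sup>2)"
    using member_le_sum[of n "{..<Suc n}" "\<lambda>k. (norm (qinner (e k) x))\<^sup>2"] by simp
  also have "\<dots> \<le> (norm x)\<^sup>2"
    unfolding norm_sum_basis[OF finite_lessThan, where c = "\<lambda>k. qinner (e k) x", symmetric]
    by (rule power_mono[OF norm_partial_expansion_le norm_ge_zero])
  finally show ?thesis
    by (rule power2_le_imp_le) simp
qed

lemma bounded_linear_qinner_basis: "bounded_linear (qinner (e n))"
  by (rule bounded_linear_intro[of _ 1])
    (simp_all add: qinner_add_right qinner_scaleR_right norm_qinner_basis_le)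

text \<open>Inserting \<open>q\<close> only scales the norms of finite blocks, so the Cauchy property carries over.\<close>

lemma left_mult_op_sums: "(\<lambda>n. e n *\<^sub>H q *\<^sub>H qinner (e n) x) sums left_mult_op e q x"
proof -
  have "summable (\<lambda>n. e n *\<^sub>H q *\<^sub>H qinner (e n) x)"
    unfolding summable_Cauchy
  proof (intro allI impI)
    fix r :: real
    assume "r > 0"
    \<comment> \<open>Adding 1 keeps the denominator positive when \<open>q\<close> is zero.\<close>
    then have "r / (norm q + 1) > 0"
      by (simp add: add_nonneg_pos)
    then obtain N where
      N: "\<And>m n. m \<ge> N \<Longrightarrow> norm (\<Sum>k=m..<n. e k *\<^sub>H qinner (e k) x) < r / (norm q + 1)"
      using sums_summable[OF basis_expansion[of x]] unfolding summable_Cauchy by blast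
    have "norm (\<Sum>k=m..<n. e k *\<^sub>H q *\<^sub>H qinner (e k) x) < r" if "m \<ge> N" for m n
    proof -
      have "norm q * norm (\<Sum>k=m..<n. e k *\<^sub>H qinner (e k) x)
          \<le> (norm q + 1) * norm (\<Sum>k=m..<n. e k *\<^sub>H qinner (e k) x)"
        by (intro mult_right_mono) auto
      also have "\<dots> < r"
        using N[OF that, of n] by (simp add: pos_less_divide_eq add_nonneg_pos mult.commute)
      finally show ?thesis
        by (simp add: norm_sum_basis_mult)
    qed
    then show "\<exists>N. \<forall>m\<ge>N. \<forall>n. norm (\<Sum>k=m..<n. e k *\<^sub>H q *\<^sub>H qinner (e k) x) < r"
      by blast
  qed
  then show ?thesis
    unfolding left_mult_op_def by (rule summable_sums)
qed

section \<open>Norm, linearity and multiplicativity of left multiplication\<close>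

lemma norm_left_mult_op: "norm (left_mult_op e q x) = norm q * norm x"
proof (rule LIMSEQ_unique)
  show "(\<lambda>N. norm (\<Sum>n<N. e n *\<^sub>H q *\<^sub>H qinner (e n) x)) \<longlonglongrightarrow> norm (left_mult_op e q x)"
    using left_mult_op_sums[of q x] unfolding sums_def by (rule tendsto_norm)
  show "(\<lambda>N. norm (\<Sum>n<N. e n *\<^sub>H q *\<^sub>H qinner (e n) x)) \<longlonglongrightarrow> norm q * norm x"
    unfolding norm_sum_basis_mult[OF finite_lessThan]
    using basis_expansion[of x] unfolding sums_def by (intro tendsto_intros)
qed

lemma left_mult_op_add: "left_mult_op e q (x + y) = left_mult_op e q x + left_mult_op e q y"
  using sums_add[OF left_mult_op_sums[of q x] left_mult_op_sums[of q y]]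
  by (intro sums_unique2[OF left_mult_op_sums]) (simp add: qinner_add_right rscale_add_right)

lemma left_mult_op_rscale: "left_mult_op e q (x *\<^sub>H p) = left_mult_op e q x *\<^sub>H p"
  using bounded_linear.sums[OF bounded_linear_rscale_left[of p] left_mult_op_sums[of q x]]
  by (intro sums_unique2[OF left_mult_op_sums]) (simp add: qinner_rscale_right rscale_mult)

lemma left_mult_op_bounded_ops: "left_mult_op e q \<in> bounded_ops"
proof -
  have "bounded_linear (left_mult_op e q)"
    by (rule bounded_linear_intro[of _ "norm q"])
      (simp_all add: left_mult_op_add scaleR_conv_rscale left_mult_op_rscale norm_left_mult_op)
  then show ?thesis
    by (simp add: bounded_ops_def left_mult_op_rscale)
qed

lemma left_mult_op_add_left: "left_mult_op e (p + q) x = left_mult_op e p x + left_mult_op e q x"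
  using sums_add[OF left_mult_op_sums[of p x] left_mult_op_sums[of q x]]
  by (intro sums_unique2[OF left_mult_op_sums]) (simp add: rscale_add_right rscale_add_left)

lemma left_mult_op_of_real: "left_mult_op e (of_real a) x = a *\<^sub>R x"
  using sums_scaleR_right[OF basis_expansion[of x], of a]
  by (intro sums_unique2[OF left_mult_op_sums])
    (simp add: of_real_def rscale_scaleR_right rscale_one rscale_scaleR_left)

lemma left_mult_op_one: "left_mult_op e 1 x = x"
  using left_mult_op_of_real[of 1] by simp

text \<open>By continuity the coefficient is computed termwise, and orthonormality leaves only the
  term \<open>k = n\<close>. This is what makes \<open>left_mult_op e\<close> multiplicative in
  \<open>q\<close>.\<close>

lemma qinner_left_mult_op: "qinner (e n) (left_mult_op e q x) = q * qinner (e n) x"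
proof -
  have "(\<lambda>k. qinner (e n) (e k *\<^sub>H q *\<^sub>H qinner (e k) x)) sums qinner (e n) (left_mult_op e q x)"
    by (intro bounded_linear.sums[OF bounded_linear_qinner_basis] left_mult_op_sums)
  moreover have "(\<lambda>k. qinner (e n) (e k *\<^sub>H q *\<^sub>H qinner (e k) x)) sums (q * qinner (e n) x)"
    using sums_single[of n "\<lambda>k. q * qinner (e k) x"]
    by (rule back_subst[of "\<lambda>f. f sums _"]) (auto simp: qinner_rscale_right qinner_basis)
  ultimately show ?thesis
    by (rule sums_unique2)
qed

lemma left_mult_op_mult: "left_mult_op e (p * q) x = left_mult_op e p (left_mult_op e q x)"
  using left_mult_op_sums[of p "left_mult_op e q x"]
  by (intro sums_unique2[OF left_mult_op_sums]) (simp add: qinner_left_mult_op rscale_mult)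

section \<open>Invertibility of \<open>Q_op\<close> at real points and the pseudo S-spectrum\<close>

lemma Q_op_left_mult_op:
  "Q_op (of_real t) (left_mult_op e q) = left_mult_op e ((q - of_real t)\<^sup>2)"
proof
  fix x
  \<comment> \<open>The real number \<open>t\<close> commutes with \<open>q\<close>, so the
    polynomial defining \<open>Q_op\<close> is a perfect square.\<close>
  have "(q - of_real t)\<^sup>2 = q * q + of_real (- 2 * t) * q + of_real (t\<^sup>2)"
    by (simp add: quat_eq_iff quat_sel_mult power2_eq_square algebra_simps del: of_real_mult)
  then show "Q_op (of_real t) (left_mult_op e q) x = left_mult_op e ((q - of_real t)\<^sup>2) x"
    by (simp only: left_mult_op_add_left left_mult_op_mult left_mult_op_of_real)
      (simp add: Q_op_def)
qed

lemma onorm_left_mult_op: "onorm (left_mult_op e q) = norm q"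
proof (rule antisym)
  show "onorm (left_mult_op e q) \<le> norm q"
    by (rule onorm_bound) (simp_all add: norm_left_mult_op)
  have "bounded_linear (left_mult_op e q)"
    using left_mult_op_bounded_ops by (simp add: bounded_ops_def)
  then show "norm q \<le> onorm (left_mult_op e q)"
    using onorm[of "left_mult_op e q" "e 0"] by (simp add: norm_left_mult_op)
qed

lemma left_mult_op_inverse:
  assumes "q \<noteq> 0"
  shows "left_mult_op e q \<circ> left_mult_op e (inverse q) = id"
    and "left_mult_op e (inverse q) \<circ> left_mult_op e q = id"
  using assms by (simp_all add: fun_eq_iff left_mult_op_mult[symmetric] left_mult_op_one)

lemma invertible_left_mult_op_iff: "invertible_op (left_mult_op e q) \<longleftrightarrow> q \<noteq> 0"
proof
  assume "invertible_op (left_mult_op e q)"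
  \<comment> \<open>Surjectivity suffices: the unit vector \<open>e 0\<close> lies in the range,
    which is impossible if all images have norm 0.\<close>
  then obtain B where "left_mult_op e q (B (e 0)) = e 0"
    by (auto simp: invertible_op_def fun_eq_iff)
  then have "norm q * norm (B (e 0)) = 1"
    by (metis norm_basis norm_left_mult_op)
  then show "q \<noteq> 0"
    by auto
next
  assume "q \<noteq> 0"
  then show "invertible_op (left_mult_op e q)"
    unfolding invertible_op_def using left_mult_op_inverse left_mult_op_bounded_ops by blast
qed

lemma onorm_inv_left_mult_op:
  assumes "q \<noteq> 0"
  shows "onorm (inv (left_mult_op e q)) = 1 / norm q"
proof -
  have "inv (left_mult_op e q) = left_mult_op e (inverse q)"
    using left_mult_op_inverse[OF assms] by (intro inv_unique_comp)
  then show ?thesis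
    by (simp add: onorm_left_mult_op norm_inverse divide_inverse)
qed

lemma of_real_mem_pseudo_S_spectrum_iff:
  assumes "\<epsilon> > 0"
  shows "of_real t \<in> pseudo_S_spectrum \<epsilon> (left_mult_op e q) \<longleftrightarrow>
    (t - qRe q)\<^sup>2 + (norm (qIm q))\<^sup>2 \<le> \<epsilon>"
proof -
  let ?r = "(q - of_real t)\<^sup>2"
  have norm_r: "norm ?r = (t - qRe q)\<^sup>2 + (norm (qIm q))\<^sup>2"
    by (simp only: norm_power) (simp add: norm_quat_def qIm_def power2_commute)
  have inverse_le: "1 / \<epsilon> \<le> 1 / n \<longleftrightarrow> n \<le> \<epsilon>" if "n > 0" for n
    using assms that by (simp add: divide_simps)
  have "of_real t \<in> pseudo_S_spectrum \<epsilon> (left_mult_op e q) \<longleftrightarrow>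
      ?r = 0 \<or> (?r \<noteq> 0 \<and> onorm (inv (left_mult_op e ?r)) \<ge> 1 / \<epsilon>)"
    by (simp only: pseudo_S_spectrum_def S_spectrum_def Un_iff mem_Collect_eq Q_op_left_mult_op
        invertible_left_mult_op_iff not_not)
  also have "\<dots> \<longleftrightarrow> ?r = 0 \<or> (?r \<noteq> 0 \<and> 1 / norm ?r \<ge> 1 / \<epsilon>)"
    using onorm_inv_left_mult_op[of ?r] by (auto simp del: power_eq_0_iff)
  also have "\<dots> \<longleftrightarrow> norm ?r \<le> \<epsilon>"
  \<comment> \<open>Points of the S-spectrum satisfy the same inequality, because there the norm is
    0 and \<epsilon> is positive.\<close>
  proof (cases "?r = 0")
    case True
    then show ?thesis
      using assms by simp
  next
    case False
    then have "norm ?r > 0"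
      using zero_less_norm_iff by blast
    then show ?thesis
      using False inverse_le by blast
  qed
  finally show ?thesis
    by (simp only: norm_r)
qed

lemma pseudo_S_spectrum_Int_Reals:
  assumes "\<epsilon> > 0"
  shows "pseudo_S_spectrum \<epsilon> (left_mult_op e q) \<inter> \<real> =
    of_real ` {t. (t - qRe q)\<^sup>2 + (norm (qIm q))\<^sup>2 \<le> \<epsilon>}"
  using of_real_mem_pseudo_S_spectrum_iff[OF assms] by (auto elim!: Reals_cases)

end

theorem theorem4p14:
  fixes e :: "nat \<Rightarrow> 'h::quat_hilbert" and q :: quat and \<epsilon> :: real
  assumes "separable_space (euclidean :: 'h topology)"
    and "orthonormal_basis e"
    and "\<epsilon> > 0"
  shows "(\<epsilon> < (norm (qIm q))\<^sup>2 \<longrightarrow>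
            pseudo_S_spectrum \<epsilon> (left_mult_op e q) \<inter> \<real> = {}) \<and>
         (\<epsilon> \<ge> (norm (qIm q))\<^sup>2 \<longrightarrow>
            pseudo_S_spectrum \<epsilon> (left_mult_op e q) \<inter> \<real> \<noteq> {} \<and>
            connected (pseudo_S_spectrum \<epsilon> (left_mult_op e q) \<inter> \<real>))"
proof -
  let ?S = "{t. (t - qRe q)\<^sup>2 + (norm (qIm q))\<^sup>2 \<le> \<epsilon>}"
  have "?S = {}" if "\<epsilon> < (norm (qIm q))\<^sup>2"
    using that zero_le_power2 by (auto simp: not_le intro: less_le_trans add_increasing)
  moreover have "?S \<noteq> {}" "connected ((of_real :: real \<Rightarrow> quat) ` ?S)" if "\<epsilon> \<ge> (norm (qIm q))\<^sup>2"
  proof -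
    have "qRe q \<in> ?S"
      using that by simp
    then show "?S \<noteq> {}"
      by blast
    \<comment> \<open>\<open>sqrt\<close> is strictly increasing on all reals, so no sign conditions
      arise. The left root is the distance from \<open>t\<close> to \<open>qRe q\<close>, which
      exhibits the set as a closed ball.\<close>
    have "(t - qRe q)\<^sup>2 + (norm (qIm q))\<^sup>2 \<le> \<epsilon> \<longleftrightarrow>
        sqrt ((t - qRe q)\<^sup>2) \<le> sqrt (\<epsilon> - (norm (qIm q))\<^sup>2)" for t
      by (simp only: real_sqrt_le_iff le_diff_eq)
    then have "?S = cball (qRe q) (sqrt (\<epsilon> - (norm (qIm q))\<^sup>2))"
      by (simp add: set_eq_iff dist_real_def abs_minus_commute)
    then have "connected ?S"
      by simp
    then show "connected ((of_real :: real \<Rightarrow> quat) ` ?S)"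
      by (intro connected_continuous_image continuous_intros)
  qed
  ultimately show ?thesis
    by (simp add: pseudo_S_spectrum_Int_Reals[OF assms(2,3)])
qed

end
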